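(* Let $n,k$ be positive integers and let $\mu=(\mu_1,\ldots,\mu_l)\subset\lambda=(\lambda_1,\ldots,\lambda_l)$ be two partitions. If $\lambda/\mu$ is a horizontal $n$-border strip of weight $k$, then $\det(\mathcal{M}(\lambda/\mu))=\operatorname{sgn}(\lambda/\mu)$.
   Context: For partitions, $\mu\subset\lambda$ means $\mu_i\le\lambda_i$ for all $i$; $\ell(\lambda)=l$ is the number of nonzero parts of $\lambda$, and $\mu$ is padded with zeros to length $l$ if necessary. Young diagrams are drawn with rows numbered from top to bottom and columns from left to right. Matrix: for $\mu\subset\lambda$, $\mathcal{M}(\lambda/\mu)=(m_{ij})$ is the $\ell(\lambda)\times\ell(\lambda)$ matrix with $m_{ij}=1$ if $\lambda_i-i\ge\mu_j-j$ and $n\mid(\lambda_i-i-\mu_j+j)$, and $m_{ij}=0$ otherwise. Border strips: a skew diagram is an $r$-border strip if it consists of $r$ boxes, is connected and contains no $2\times 2$ square. Its height $ht$ is its number of rows minus 1. Its starting box is its northeasternmost box. $(\lambda/\mu)\!\uparrow$ is the set consisting of the top box of each (nonempty) column of $\lambda/\mu$. Horizontal $n$-border strip: $\lambda/\mu$ is a horizontal $n$-border strip of weight $k$ if there is a chain of partitions $\mu=\alpha^{(0)}\subset\alpha^{(1)}\subset\cdots\subset\alpha^{(k)}=\lambda$ such that each $\alpha^{(i)}/\alpha^{(i-1)}$ is an $n$-border strip, the starting box of each $\alpha^{(i)}/\alpha^{(i-1)}$ lies in $(\lambda/\mu)\!\uparrow$, and for $i<j$ the starting box of $\alpha^{(i)}/\alpha^{(i-1)}$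 lies southwest (weakly below and strictly to the left) of the starting box of $\alpha^{(j)}/\alpha^{(j-1)}$. Such a chain is unique if it exists, and then $\operatorname{sgn}(\lambda/\mu):=\prod_{i=1}^{k}(-1)^{ht(\alpha^{(i)}/\alpha^{(i-1)})}$. *)

theory Defs
  imports "Jordan_Normal_Form.Determinant"
begin

text \<open>
  A partition is the function giving its parts, extended by zeros, so that no explicit padding is
  needed. Rows and columns are numbered from 0: row 0 is the top row and column 0 the leftmost one.
  Containment of partitions is the pointwise order on functions.
\<close>

definition is_partition :: "(nat \<Rightarrow> nat) \<Rightarrow> bool" where
  "is_partition p \<longleftrightarrow> antimono p \<and> finite {i. p i \<noteq> 0}"

definition num_parts :: "(nat \<Rightarrow> nat) \<Rightarrow> nat" where
  "num_parts p = card {i. p i \<noteq> 0}"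

type_synonym box = "nat \<times> nat"  \<comment> \<open>(row, column)\<close>

definition skew_diagram :: "(nat \<Rightarrow> nat) \<Rightarrow> (nat \<Rightarrow> nat) \<Rightarrow> box set" where
  "skew_diagram lam mu = {(i, j). mu i \<le> j \<and> j < lam i}"

text \<open>Since the condition only involves differences, 0-based indices give the same matrix.\<close>

definition strip_matrix :: "nat \<Rightarrow> (nat \<Rightarrow> nat) \<Rightarrow> (nat \<Rightarrow> nat) \<Rightarrow> int mat" where
  "strip_matrix n lam mu = mat (num_parts lam) (num_parts lam) (\<lambda>(i, j).
     if int (lam i) - int i \<ge> int (mu j) - int j
        \<and> int n dvd (int (lam i) - int i - int (mu j) + int j)
     then 1 else 0)"

fun adjacent_boxes :: "box \<Rightarrow> box \<Rightarrow> bool" where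
  "adjacent_boxes (i, j) (i', j') \<longleftrightarrow>
     (i = i' \<and> (j' = Suc j \<or> j = Suc j')) \<or> (j = j' \<and> (i' = Suc i \<or> i = Suc i'))"

definition connected_boxes :: "box set \<Rightarrow> bool" where
  "connected_boxes D \<longleftrightarrow>
     (\<forall>x\<in>D. \<forall>y\<in>D. (x, y) \<in> {(a, b). a \<in> D \<and> b \<in> D \<and> adjacent_boxes a b}\<^sup>*)"

definition border_strip :: "nat \<Rightarrow> (nat \<Rightarrow> nat) \<Rightarrow> (nat \<Rightarrow> nat) \<Rightarrow> bool" where
  "border_strip r lam mu \<longleftrightarrow>
     is_partition mu \<and> is_partition lam \<and> mu \<le> lam \<and>
     card (skew_diagram lam mu) = r \<and>
     connected_boxes (skew_diagram lam mu) \<and>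
     \<not> (\<exists>i j. {(i, j), (i, Suc j), (Suc i, j), (Suc i, Suc j)} \<subseteq> skew_diagram lam mu)"

definition strip_height :: "box set \<Rightarrow> nat" where
  "strip_height D = card (fst ` D) - 1"

text \<open>The northeasternmost box: weakly above and weakly to the right of every box.\<close>

definition starting_box :: "box set \<Rightarrow> box" where
  "starting_box D = (THE b. b \<in> D \<and> (\<forall>c\<in>D. fst b \<le> fst c \<and> snd c \<le> snd b))"

definition top_boxes :: "box set \<Rightarrow> box set" where
  "top_boxes D = {(i, j) \<in> D. \<forall>i'. (i', j) \<in> D \<longrightarrow> i \<le> i'}"

definition southwest_of :: "box \<Rightarrow> box \<Rightarrow> bool" where
  "southwest_of b c \<longleftrightarrow> fst c \<le> fst b \<and> snd b < snd c"

text \<open>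
  A chain is listed from \<open>mu\<close> to \<open>lam\<close>; its \<open>i\<close>-th strip, counted from 0, is the skew diagram
  between the entries \<open>i\<close> and \<open>i + 1\<close>.
\<close>

abbreviation chain_strip :: "(nat \<Rightarrow> nat) list \<Rightarrow> nat \<Rightarrow> box set" where
  "chain_strip as i \<equiv> skew_diagram (as ! Suc i) (as ! i)"

definition horizontal_strip_chain ::
  "nat \<Rightarrow> nat \<Rightarrow> (nat \<Rightarrow> nat) \<Rightarrow> (nat \<Rightarrow> nat) \<Rightarrow> (nat \<Rightarrow> nat) list \<Rightarrow> bool" where
  "horizontal_strip_chain n k lam mu as \<longleftrightarrow>
     length as = Suc k \<and> as ! 0 = mu \<and> as ! k = lam \<and>
     (\<forall>i\<le>k. is_partition (as ! i)) \<and>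
     (\<forall>i<k. border_strip n (as ! Suc i) (as ! i) \<and>
            starting_box (chain_strip as i) \<in> top_boxes (skew_diagram lam mu)) \<and>
     (\<forall>i j. i < j \<and> j < k \<longrightarrow>
            southwest_of (starting_box (chain_strip as i)) (starting_box (chain_strip as j)))"

definition horizontal_border_strip :: "nat \<Rightarrow> nat \<Rightarrow> (nat \<Rightarrow> nat) \<Rightarrow> (nat \<Rightarrow> nat) \<Rightarrow> bool" where
  "horizontal_border_strip n k lam mu \<longleftrightarrow> (\<exists>as. horizontal_strip_chain n k lam mu as)"

text \<open>
  The chain of a horizontal \<open>n\<close>-border strip of weight \<open>k\<close> is unique. The weight is an argument
  although it is determined by \<open>n\<close> and the two partitions.
\<close>

definition strip_sgn :: "nat \<Rightarrow> nat \<Rightarrow> (nat \<Rightarrow> nat) \<Rightarrow> (nat \<Rightarrow> nat) \<Rightarrow> int" where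
  "strip_sgn n k lam mu =
     (let as = (THE as. horizontal_strip_chain n k lam mu as)
      in \<Prod>i<k. (-1) ^ strip_height (chain_strip as i))"

end

theory Submission imports Defs begin

text \<open>
  Encode a partition \<open>p\<close> by the strictly decreasing sequence \<open>p i - i\<close>. Adding an \<open>n\<close>-border strip
  increases one term of this sequence by \<open>n\<close> and moves it up by the height of the strip, so it permutes
  the rows of the matrix by a cycle and then replaces \<open>x\<close> by \<open>x + n\<close> in one row. The latter changes
  nothing unless \<open>x + n = mu j - j\<close> for some \<open>j\<close>, which is excluded because the starting box of the
  strip is a top box. Hence every strip of the chain contributes its sign, starting from the
  unitriangular matrix of \<open>mu/mu\<close>.

  The chain is unique because the last starting box lies in the topmost nonempty row of \<open>lam/mu\<close>,
  and an \<open>n\<close>-border strip is determined by its outer shape and the row of its starting box.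
\<close>

section \<open>The shape of a border strip\<close>

text \<open>In terms of the sequences \<open>lam i - i\<close> and \<open>mu i - i\<close>, the
  middle clause says that entry \<open>i\<close> of \<open>mu\<close> is entry \<open>i + 1\<close>
  of \<open>lam\<close> for \<open>p <= i < q\<close>. The last clause says that entry
  \<open>q\<close> of \<open>mu\<close> is raised by \<open>n\<close> and lands in place
  \<open>p\<close>; it takes over the role of the box count.\<close>

definition strip_shape :: "nat \<Rightarrow> nat \<Rightarrow> nat \<Rightarrow> (nat \<Rightarrow> nat) \<Rightarrow> (nat \<Rightarrow> nat) \<Rightarrow> bool" where
  "strip_shape n p q lam mu \<longleftrightarrow>
     p \<le> q \<and> (\<forall>i. i < p \<or> q < i \<longrightarrow> mu i = lam i) \<and>
     (\<forall>i. p \<le> i \<and> i < q \<longrightarrow> Suc (mu i) = lam (Suc i)) \<and> mu q < lam q \<and>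
     int (lam p) - int p = int (mu q) - int q + int n"

lemma strip_shape_less:
  assumes "strip_shape n p q lam mu" "antimono lam" "p \<le> i" "i \<le> q"
  shows "mu i < lam i"
proof (cases "i = q")
  case True
  then show ?thesis using assms by (simp add: strip_shape_def)
next
  case False
  then have "Suc (mu i) = lam (Suc i)" using assms by (simp add: strip_shape_def)
  also have "\<dots> \<le> lam i" using assms(2) by (simp add: antimonoD)
  finally show ?thesis by simp
qed

text \<open>A path that gets below row \<open>i\<close> must at some point step from row
  \<open>i\<close> to the next one, and such a step keeps its column.\<close>

lemma connected_boxes_crossing:
  assumes "connected_boxes D" "(a, b) \<in> D" "(c, d) \<in> D" "a \<le> i" "i < c"
  shows "\<exists>j. (i, j) \<in> D \<and> (Suc i, j) \<in> D"
proof -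
  let ?R = "{(x, y). x \<in> D \<and> y \<in> D \<and> adjacent_boxes x y}"
  have "((a, b), (c, d)) \<in> ?R\<^sup>*"
    using assms by (auto simp: connected_boxes_def)
  then have "i < fst (c, d) \<longrightarrow> (\<exists>j. (i, j) \<in> D \<and> (Suc i, j) \<in> D)"
  proof (induction rule: rtrancl_induct)
    case base
    then show ?case using assms by simp
  next
    case (step y z)
    obtain r s r' s' where yz: "y = (r, s)" "z = (r', s')" by (cases y, cases z) auto
    show ?case
    proof
      assume "i < fst z"
      show "\<exists>j. (i, j) \<in> D \<and> (Suc i, j) \<in> D"
      proof (cases "i < r")
        case True
        then show ?thesis using step yz by simp
      next
        case False
        then have "r = i" "r' = Suc i" "s' = s"
          using step(2) yz \<open>i < fst z\<close> by auto
        then show ?thesis using step(2) yz by auto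
      qed
    qed
  qed
  then show ?thesis using assms by simp
qed

lemma skew_diagram_eq_Sigma:
  "skew_diagram lam mu = Sigma {i. mu i < lam i} (\<lambda>i. {mu i..<lam i})"
  by (auto simp: skew_diagram_def)

lemma starting_box_eqI:
  assumes "b \<in> D" "\<And>c. c \<in> D \<Longrightarrow> fst b \<le> fst c \<and> snd c \<le> snd b"
  shows "starting_box D = b"
  unfolding starting_box_def
proof (rule the_equality)
  show "b \<in> D \<and> (\<forall>c\<in>D. fst b \<le> fst c \<and> snd c \<le> snd b)" using assms by blast
next
  fix b' assume "b' \<in> D \<and> (\<forall>c\<in>D. fst b' \<le> fst c \<and> snd c \<le> snd b')"
  then show "b' = b" using assms by (metis dual_order.antisym prod_eqI)
qed

lemma border_strip_shape:
  assumes strip: "border_strip n lam mu" and "n > 0"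
  obtains p q where "strip_shape n p q lam mu"
    "starting_box (skew_diagram lam mu) = (p, lam p - 1)"
    "strip_height (skew_diagram lam mu) = q - p"
proof -
  let ?D = "skew_diagram lam mu"
  let ?R = "{i. mu i < lam i}"
  have anti: "antimono lam" "antimono mu" and fin: "finite {i. lam i \<noteq> 0}"
    and le: "\<And>i. mu i \<le> lam i" and card: "card ?D = n" and conn: "connected_boxes ?D"
    and no22: "\<And>i j. \<not> {(i, j), (i, Suc j), (Suc i, j), (Suc i, Suc j)} \<subseteq> ?D"
    using strip by (auto simp: border_strip_def is_partition_def le_fun_def)
  have finR: "finite ?R" by (rule finite_subset[OF _ fin]) auto
  have neR: "?R \<noteq> {}"
  proof
    assume "?R = {}"
    then have "?D = {}" by (simp add: skew_diagram_eq_Sigma)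
    then show False using card \<open>n > 0\<close> by simp
  qed
  define p q where "p = Min ?R" and "q = Max ?R"
  have pR: "mu p < lam p" and qR: "mu q < lam q"
    using Min_in[OF finR neR] Max_in[OF finR neR] by (auto simp: p_def q_def)
  have range: "p \<le> i \<and> i \<le> q" if "mu i < lam i" for i
    using that finR by (auto simp: p_def q_def)
  have pq: "p \<le> q" using range pR by blast
  \<comment> \<open>Connectedness makes rows \<open>i\<close> and \<open>i + 1\<close> share a
    column; if they shared two, columns \<open>mu i\<close> and \<open>mu i + 1\<close> would give a
    2 by 2 square.\<close>
  have step: "Suc (mu i) = lam (Suc i)" if i: "p \<le> i" "i < q" for i
  proof -
    have "(p, mu p) \<in> ?D" "(q, mu q) \<in> ?D" using pR qR by (auto simp: skew_diagram_def)
    then obtain j where "(i, j) \<in> ?D" "(Suc i, j) \<in> ?D"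
      using connected_boxes_crossing[OF conn] i by blast
    then have "mu i < lam (Suc i)" by (auto simp: skew_diagram_def)
    moreover have "\<not> Suc (mu i) < lam (Suc i)"
    proof
      assume "Suc (mu i) < lam (Suc i)"
      moreover have "lam (Suc i) \<le> lam i" "mu (Suc i) \<le> mu i"
        using anti by (simp_all add: antimonoD)
      ultimately show False using no22[of i "mu i"] by (auto simp: skew_diagram_def)
    qed
    ultimately show ?thesis by simp
  qed
  have less: "mu i < lam i" if "p \<le> i" "i \<le> q" for i
  proof (cases "i = q")
    case False
    then have "Suc (mu i) = lam (Suc i)" using step that by simp
    also have "\<dots> \<le> lam i" using anti by (simp add: antimonoD)
    finally show ?thesis by simp
  qed (use qR in simp)
  have R: "?R = {p..q}" by (rule Set.set_eqI) (metis range less atLeastAtMost_iff mem_Collect_eq)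
  have "n = (\<Sum>i\<in>{p..q}. lam i - mu i)"
    using card by (simp add: skew_diagram_eq_Sigma R)
  then have "int n = (\<Sum>i\<in>{p..q}. int (lam i) - int (mu i))"
    using le by (simp only: of_nat_sum of_nat_diff)
  also have "\<dots> = (\<Sum>i\<in>{p..<q}. int (lam i) - int (mu i)) + (int (lam q) - int (mu q))"
    using pq by (simp add: atLeastLessThanSuc_atLeastAtMost[symmetric])
  \<comment> \<open>By \<open>step\<close>, \<open>mu i\<close> is \<open>lam (i + 1) - 1\<close>,
    so the row lengths telescope.\<close>
  also have "(\<Sum>i\<in>{p..<q}. int (lam i) - int (mu i))
      = (\<Sum>i\<in>{p..<q}. (int (Suc i) - int (lam (Suc i))) - (int i - int (lam i)))"
  proof (intro sum.cong refl)
    fix i assume "i \<in> {p..<q}"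
    then show "int (lam i) - int (mu i) = (int (Suc i) - int (lam (Suc i))) - (int i - int (lam i))"
      using step[of i] by simp
  qed
  also have "\<dots> = (int q - int (lam q)) - (int p - int (lam p))"
    using pq by (rule sum_Suc_diff')
  finally have size: "int (lam p) - int p = int (mu q) - int q + int n" by simp
  have out: "mu i = lam i" if "i < p \<or> q < i" for i
    using that range[of i] le[of i] by (metis le_neq_implies_less not_less)
  have "strip_shape n p q lam mu"
    using pq out step qR size by (simp add: strip_shape_def)
  moreover have "starting_box ?D = (p, lam p - 1)"
  proof (rule starting_box_eqI)
    show "(p, lam p - 1) \<in> ?D" using pR by (auto simp: skew_diagram_def)
  next
    fix c assume "c \<in> ?D"
    then obtain i j where c: "c = (i, j)" "mu i \<le> j" "j < lam i"
      by (auto simp: skew_diagram_def)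
    then have "p \<le> i" using range[of i] by simp
    then have "lam i \<le> lam p" using anti by (simp add: antimonoD)
    then show "fst (p, lam p - 1) \<le> fst c \<and> snd c \<le> snd (p, lam p - 1)"
      using c \<open>p \<le> i\<close> by auto
  qed
  moreover have "strip_height ?D = q - p"
  proof -
    have "fst ` ?D = ?R" by (force simp: skew_diagram_def)
    then show ?thesis using pq by (simp add: strip_height_def R)
  qed
  ultimately show thesis by (rule that)
qed

text \<open>The two size equations give \<open>mu q - q = mu' q' - q'\<close>. If
  \<open>q < q'\<close>, then row \<open>q + 1\<close> is untouched by the first strip, so
  \<open>mu' q' < lam q' <= lam (q + 1) = mu (q + 1) <= mu q\<close>, a contradiction. Equality of
  the ends follows by exchanging the two strips.\<close>

lemma strip_shape_end_unique:
  assumes "strip_shape n p q lam mu" "strip_shape n p q' lam mu'"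
    and "antimono lam" "antimono mu"
  shows "q' \<le> q"
proof (rule ccontr)
  assume "\<not> q' \<le> q"
  then have "mu (Suc q) = lam (Suc q)" using assms(1) by (simp add: strip_shape_def)
  moreover have "lam q' \<le> lam (Suc q)" "mu (Suc q) \<le> mu q"
    using \<open>\<not> q' \<le> q\<close> assms(3,4) by (simp_all add: antimonoD)
  ultimately show False
    using assms(1,2) \<open>\<not> q' \<le> q\<close> by (simp add: strip_shape_def)
qed

lemma strip_shape_unique:
  assumes "strip_shape n p q lam mu" "strip_shape n p q' lam mu'"
    and "antimono lam" "antimono mu" "antimono mu'"
  shows "mu = mu'"
proof
  fix i
  have q: "q' = q"
    using strip_shape_end_unique assms by (meson le_antisym)
  consider "i < p \<or> q < i" | "p \<le> i" "i < q" | "i = q" by linarith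
  then show "mu i = mu' i"
  proof cases
    case 2
    then have "Suc (mu i) = Suc (mu' i)" using assms(1,2) q by (simp add: strip_shape_def)
    then show ?thesis by simp
  next
    case 1
    then have "mu i = lam i" "mu' i = lam i" using assms(1,2) q by (auto simp: strip_shape_def)
    then show ?thesis by simp
  next
    case 3
    then show ?thesis using assms(1,2) q by (simp add: strip_shape_def)
  qed
qed

section \<open>Uniqueness of the chain\<close>

lemma horizontal_strip_chain_0:
  "horizontal_strip_chain n 0 lam mu as \<longleftrightarrow> as = [mu] \<and> lam = mu \<and> is_partition mu"
  by (auto simp: horizontal_strip_chain_def length_Suc_conv)

lemma top_boxes_mono:
  assumes "b \<in> top_boxes D" "b \<in> E" "E \<subseteq> D"
  shows "b \<in> top_boxes E"
  using assms by (auto simp: top_boxes_def)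

lemma horizontal_strip_chain_le:
  assumes "horizontal_strip_chain n k lam mu as" "i \<le> j" "j \<le> k"
  shows "as ! i \<le> as ! j"
  using assms(2,3)
proof (induction j rule: dec_induct)
  case (step m)
  then have "as ! m \<le> as ! Suc m"
    using assms(1) by (auto simp: horizontal_strip_chain_def border_strip_def)
  then show ?case using step by (auto intro: order_trans)
qed simp

text \<open>Removes the outermost strip, for the inductions on the weight. The southwest order makes
  the last starting box the topmost one, so no strip of the chain meets a row above
  \<open>p\<close>.\<close>

lemma horizontal_strip_chain_Suc:
  assumes chain: "horizontal_strip_chain n (Suc k) lam mu as" and "n > 0"
  obtains p q where "horizontal_strip_chain n k (as ! k) mu (take (Suc k) as)"
    "strip_shape n p q lam (as ! k)" "is_partition lam" "is_partition (as ! k)"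
    "strip_height (chain_strip as k) = q - p"
    "(p, lam p - 1) \<in> top_boxes (skew_diagram lam mu)"
    "\<And>i. i < p \<Longrightarrow> lam i = mu i"
proof -
  have len: "length as = Suc (Suc k)" and ends: "as ! 0 = mu" "as ! Suc k = lam"
    and part: "\<And>i. i \<le> Suc k \<Longrightarrow> is_partition (as ! i)"
    and bs: "\<And>i. i < Suc k \<Longrightarrow> border_strip n (as ! Suc i) (as ! i)"
    and top: "\<And>i. i < Suc k \<Longrightarrow>
      starting_box (chain_strip as i) \<in> top_boxes (skew_diagram lam mu)"
    and sw: "\<And>i j. i < j \<Longrightarrow> j < Suc k \<Longrightarrow>
      southwest_of (starting_box (chain_strip as i)) (starting_box (chain_strip as j))"
    using chain by (auto simp: horizontal_strip_chain_def)
  note mono = horizontal_strip_chain_le[OF chain]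
  obtain p q where pq: "strip_shape n p q (as ! Suc k) (as ! k)"
    "starting_box (chain_strip as k) = (p, (as ! Suc k) p - 1)"
    "strip_height (chain_strip as k) = q - p"
    by (rule border_strip_shape[OF bs[OF lessI] \<open>n > 0\<close>])
  have "horizontal_strip_chain n k (as ! k) mu (take (Suc k) as)"
  proof -
    \<comment> \<open>The shorter chain lives in a smaller diagram. A top box of
      \<open>lam/mu\<close> remains a top box there once it is known to lie in it, which holds since
      the first row of strip \<open>i\<close> is nonempty and lies between \<open>mu\<close> and
      \<open>as ! k\<close>.\<close>
    have "starting_box (chain_strip as i) \<in> top_boxes (skew_diagram (as ! k) mu)"
      if i: "i < k" for i
    proof (rule top_boxes_mono)
      show "starting_box (chain_strip as i) \<in> top_boxes (skew_diagram lam mu)"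
        using top i by simp
      have "as ! k \<le> lam" using mono[of k "Suc k"] ends by simp
      then show "skew_diagram (as ! k) mu \<subseteq> skew_diagram lam mu"
        by (auto simp: skew_diagram_def le_fun_def intro: less_le_trans)
      obtain r s where rs: "strip_shape n r s (as ! Suc i) (as ! i)"
        "starting_box (chain_strip as i) = (r, (as ! Suc i) r - 1)"
        by (rule border_strip_shape[OF bs[OF less_SucI[OF i]] \<open>n > 0\<close>])
      have "antimono (as ! Suc i)" using part[of "Suc i"] i by (simp add: is_partition_def)
      then have "(as ! i) r < (as ! Suc i) r"
        using strip_shape_less[OF rs(1)] rs(1) by (simp add: strip_shape_def)
      moreover have "mu r \<le> (as ! i) r" "(as ! Suc i) r \<le> (as ! k) r"
        using mono[of 0 i] mono[of "Suc i" k] i ends by (auto simp: le_fun_def)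
      ultimately show "starting_box (chain_strip as i) \<in> skew_diagram (as ! k) mu"
        unfolding rs(2) by (auto simp: skew_diagram_def)
    qed
    then show ?thesis
      using len ends part bs sw by (auto simp: horizontal_strip_chain_def)
  qed
  moreover have "lam i = mu i" if "i < p" for i
  proof -
    have "(as ! t) i = mu i" if "t \<le> Suc k" for t
      using that
    proof (induction t)
      case 0
      then show ?case using ends by simp
    next
      case (Suc t)
      obtain r s where rs: "strip_shape n r s (as ! Suc t) (as ! t)"
        "starting_box (chain_strip as t) = (r, (as ! Suc t) r - 1)"
        by (rule border_strip_shape[OF bs[OF Suc_le_lessD[OF Suc.prems]] \<open>n > 0\<close>])
      \<comment> \<open>For \<open>t = k\<close> both descriptions are of the same starting box; an
        earlier strip starts weakly below the last one.\<close>
      have "p \<le> r"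
      proof (cases "t = k")
        case True
        then show ?thesis using rs pq by simp
      next
        case False
        then show ?thesis
          using sw[of t k] Suc.prems rs(2) pq(2) by (simp add: southwest_of_def)
      qed
      then show ?case
        using rs(1) Suc \<open>i < p\<close> by (auto simp: strip_shape_def)
    qed
    then show ?thesis using ends by blast
  qed
  ultimately show thesis
    using that[of p q] pq ends part[of k] part[of "Suc k"] top[of k] by simp
qed

text \<open>The right-hand side mentions neither \<open>nu\<close> nor the chain, so the last strips
  of any two chains start in the same row.\<close>

lemma strip_shape_top_row_unique:
  assumes "strip_shape n p q lam nu" "\<And>i. i < p \<Longrightarrow> lam i = mu i" "(p, lam p - 1) \<in> skew_diagram lam mu"
  shows "p = (LEAST i. lam i \<noteq> mu i)"
proof (rule sym, rule Least_equality)
  show "lam p \<noteq> mu p" using assms(3) by (auto simp: skew_diagram_def)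
  show "p \<le> i" if "lam i \<noteq> mu i" for i using that assms(2) by (meson not_less)
qed

lemma horizontal_strip_chain_unique:
  assumes "horizontal_strip_chain n k lam mu as" "horizontal_strip_chain n k lam mu bs" "n > 0"
  shows "as = bs"
  using assms(1,2)
proof (induction k arbitrary: lam as bs)
  case 0
  then show ?case by (simp add: horizontal_strip_chain_0)
next
  case (Suc k)
  obtain p q where A: "horizontal_strip_chain n k (as ! k) mu (take (Suc k) as)"
    "strip_shape n p q lam (as ! k)" "is_partition lam" "is_partition (as ! k)"
    "(p, lam p - 1) \<in> top_boxes (skew_diagram lam mu)" "\<And>i. i < p \<Longrightarrow> lam i = mu i"
    using horizontal_strip_chain_Suc[OF Suc.prems(1) \<open>n > 0\<close>] by metis
  obtain p' q' where B: "horizontal_strip_chain n k (bs ! k) mu (take (Suc k) bs)"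
    "strip_shape n p' q' lam (bs ! k)" "is_partition lam" "is_partition (bs ! k)"
    "(p', lam p' - 1) \<in> top_boxes (skew_diagram lam mu)" "\<And>i. i < p' \<Longrightarrow> lam i = mu i"
    using horizontal_strip_chain_Suc[OF Suc.prems(2) \<open>n > 0\<close>] by metis
  have "p = p'"
    using strip_shape_top_row_unique[OF A(2,6)] strip_shape_top_row_unique[OF B(2,6)] A(5) B(5)
    by (simp add: top_boxes_def)
  then have "as ! k = bs ! k"
    using strip_shape_unique A B by (metis is_partition_def)
  then have "take (Suc k) as = take (Suc k) bs"
    using Suc.IH A(1) B(1) by simp
  moreover have "length as = Suc (Suc k)" "length bs = Suc (Suc k)" "as ! Suc k = bs ! Suc k"
    using Suc.prems by (auto simp: horizontal_strip_chain_def)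
  ultimately show ?case
    by (metis lessI take_Suc_conv_app_nth take_all order_refl)
qed

section \<open>The determinant\<close>

text \<open>Oriented so that row \<open>i\<close> of the matrix for the larger partition comes from
  row \<open>cycle_up p q i\<close> of the matrix for the smaller one.\<close>

definition cycle_up :: "nat \<Rightarrow> nat \<Rightarrow> nat \<Rightarrow> nat" where
  "cycle_up p q i = (if i = p then q else if p < i \<and> i \<le> q then i - 1 else i)"

lemma cycle_up_permutes_sign:
  assumes "p \<le> q"
  shows "cycle_up p q permutes {p..q} \<and> sign (cycle_up p q) = (-1) ^ (q - p)"
  using assms
proof (induction q rule: dec_induct)
  case base
  have "cycle_up p p = id" by (auto simp: cycle_up_def fun_eq_iff)
  then show ?case by (simp add: permutes_id flip: id_def)
next
  case (step q)
  let ?t = "Transposition.transpose q (Suc q)"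
  \<comment> \<open>Lengthening the cycle by one row costs one adjacent transposition, hence one
    sign.\<close>
  have eq: "cycle_up p (Suc q) = ?t \<circ> cycle_up p q"
    using step.hyps by (auto simp: cycle_up_def fun_eq_iff Transposition.transpose_def)
  have "cycle_up p q permutes {p..Suc q}"
    using step.IH by (auto intro: permutes_subset)
  moreover have "?t permutes {p..Suc q}"
    using step.hyps by (intro permutes_swap_id) auto
  ultimately have perm: "cycle_up p (Suc q) permutes {p..Suc q}"
    unfolding eq by (rule permutes_compose)
  have "permutation (cycle_up p q)"
    using step.IH permutation_permutes by blast
  then have "sign (cycle_up p (Suc q)) = sign ?t * sign (cycle_up p q)"
    unfolding eq by (intro sign_compose permutation_swap_id)
  also have "\<dots> = (-1) ^ (Suc q - p)"
    using step by (simp add: sign_swap_id Suc_diff_le)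
  finally show ?case using perm by simp
qed

text \<open>The size is a parameter, as the number of parts may change along a chain.\<close>

definition sized_strip_matrix :: "nat \<Rightarrow> nat \<Rightarrow> (nat \<Rightarrow> nat) \<Rightarrow> (nat \<Rightarrow> nat) \<Rightarrow> int mat" where
  "sized_strip_matrix n N lam mu = mat N N (\<lambda>(i, j).
     if int (lam i) - int i \<ge> int (mu j) - int j
        \<and> int n dvd (int (lam i) - int i - int (mu j) + int j)
     then 1 else 0)"

lemma sized_strip_matrix_carrier [simp]: "sized_strip_matrix n N lam mu \<in> carrier_mat N N"
  by (simp add: sized_strip_matrix_def)

text \<open>Since \<open>mu i - i\<close> strictly decreases, the order condition fails below the
  diagonal, while every diagonal entry is 1.\<close>

lemma det_sized_strip_matrix_self:
  assumes "antimono mu"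
  shows "det (sized_strip_matrix n N mu mu) = 1"
proof -
  let ?M = "sized_strip_matrix n N mu mu"
  have "upper_triangular ?M"
  proof
    fix i j assume ji: "j < i" and "i < dim_row ?M"
    then have "i < N" by (simp add: sized_strip_matrix_def)
    moreover have "mu i \<le> mu j" using assms ji by (simp add: antimonoD)
    ultimately show "?M $$ (i, j) = 0" using ji by (simp add: sized_strip_matrix_def)
  qed
  then have "det ?M = prod_list (diag_mat ?M)"
    by (rule det_upper_triangular[where n = N]) simp
  also have "diag_mat ?M = replicate N 1"
    by (auto simp: diag_mat_def sized_strip_matrix_def intro: nth_equalityI)
  finally show ?thesis by simp
qed

text \<open>Equality with \<open>j < p\<close> would give \<open>mu j < lam p <= lam j\<close>, so
  row \<open>j\<close> would have a box above the starting box in its column. Equality with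
  \<open>j >= p\<close> would give \<open>mu j >= lam p > mu p\<close>, although \<open>mu\<close>
  is weakly decreasing.\<close>

lemma top_box_row_end_neq:
  assumes "is_partition lam" "mu \<le> lam" "antimono mu" "(p, lam p - 1) \<in> top_boxes (skew_diagram lam mu)"
  shows "int (mu j) - int j \<noteq> int (lam p) - int p"
proof
  assume eq: "int (mu j) - int j = int (lam p) - int p"
  have box: "mu p < lam p" and top: "\<And>i. (i, lam p - 1) \<in> skew_diagram lam mu \<Longrightarrow> p \<le> i"
    using assms(4) by (auto simp: top_boxes_def skew_diagram_def)
  have anti: "antimono lam" using assms(1) by (simp add: is_partition_def)
  consider "j < p" | "j = p" | "p < j" by linarith
  then show False
  proof cases
    case 1
    then have "lam p \<le> lam j" using anti by (simp add: antimonoD)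
    then have "(j, lam p - 1) \<in> skew_diagram lam mu"
      using 1 eq box by (auto simp: skew_diagram_def)
    then show False using top 1 by force
  next
    case 2
    then show False using eq box by simp
  next
    case 3
    then have "mu j \<le> mu p" using assms(3) by (simp add: antimonoD)
    then show False using eq box 3 by simp
  qed
qed

text \<open>Outside row \<open>p\<close> the entry conditions match exactly after the cycle; only
  row \<open>p\<close>, where the compared number grows by \<open>n\<close>, needs
  \<open>neq\<close>.\<close>

lemma det_sized_strip_matrix_step:
  assumes shape: "strip_shape n p q lam nu" and "n > 0"
    and neq: "\<And>j. int (mu j) - int j \<noteq> int (lam p) - int p"
    and zero: "\<And>i. i \<ge> N \<Longrightarrow> lam i = 0"
  shows "det (sized_strip_matrix n N lam mu) = (-1) ^ (q - p) * det (sized_strip_matrix n N nu mu)"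
proof -
  let ?c = "cycle_up p q"
  have pq: "p \<le> q" and "nu q < lam q" and size: "int (lam p) - int p = int (nu q) - int q + int n"
    using shape by (auto simp: strip_shape_def)
  \<comment> \<open>Row \<open>q\<close> of \<open>lam\<close> is nonzero, so the cycle moves only
    rows of the matrix.\<close>
  then have "q < N" using zero[of q] by (metis not_less not_less_zero)
  have perm: "?c permutes {0..<N}"
    using cycle_up_permutes_sign[OF pq] \<open>q < N\<close> by (auto intro: permutes_subset)
  have "sized_strip_matrix n N lam mu = mat N N (\<lambda>(i, j). sized_strip_matrix n N nu mu $$ (?c i, j))"
  proof (rule eq_matI; clarsimp)
    fix i j assume ij: "i < N" "j < N"
    have cN: "?c i < N" using permutes_in_image[OF perm] ij by simp
    let ?P = "\<lambda>x. int (mu j) - int j \<le> x \<and> int n dvd (x - int (mu j) + int j)"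
    have "?P (int (lam i) - int i) \<longleftrightarrow> ?P (int (nu (?c i)) - int (?c i))"
    proof (cases "i = p")
      case True
      define d where "d = int (nu q) - int q - int (mu j) + int j"
      have d: "int (lam p) - int p - int (mu j) + int j = d + int n"
        using size by (simp add: d_def)
      \<comment> \<open>\<open>d\<close> and \<open>d + n\<close> agree modulo \<open>n\<close>. A
        multiple \<open>d + n\<close> of \<open>n\<close> can be nonnegative with \<open>d\<close>
        negative only if it is 0, which \<open>neq\<close> rules out.\<close>
      have "d + int n \<noteq> 0" using d neq[of j] by linarith
      then have "0 \<le> d + int n \<and> int n dvd d + int n \<longleftrightarrow> 0 \<le> d \<and> int n dvd d"
        using zdvd_imp_le[of "int n" "d + int n"] by auto
      moreover have "int (mu j) - int j \<le> int (lam p) - int p \<longleftrightarrow> 0 \<le> d + int n"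
        "int (mu j) - int j \<le> int (nu q) - int q \<longleftrightarrow> 0 \<le> d"
        using d d_def by linarith+
      ultimately have "?P (int (lam p) - int p) \<longleftrightarrow> ?P (int (nu q) - int q)"
        by (simp only: d d_def[symmetric])
      then show ?thesis using True by (simp add: cycle_up_def)
    next
      case False
      have "int (nu (?c i)) - int (?c i) = int (lam i) - int i"
      proof (cases "p < i \<and> i \<le> q")
        case True
        then obtain m where m: "i = Suc m" "p \<le> m" "m < q" by (cases i) auto
        then have "Suc (nu m) = lam i" using shape by (simp add: strip_shape_def)
        then show ?thesis using m by (simp add: cycle_up_def)
      next
        case False
        then have "nu i = lam i" using shape \<open>i \<noteq> p\<close> by (auto simp: strip_shape_def)
        then show ?thesis using False \<open>i \<noteq> p\<close> by (auto simp: cycle_up_def)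
      qed
      then show ?thesis by simp
    qed
    then show "sized_strip_matrix n N lam mu $$ (i, j) = sized_strip_matrix n N nu mu $$ (?c i, j)"
      using ij cN by (simp add: sized_strip_matrix_def)
  qed (simp_all add: sized_strip_matrix_def)
  then show ?thesis
    using det_permute_rows[OF sized_strip_matrix_carrier[of n N nu mu] perm]
      cycle_up_permutes_sign[OF pq] by simp
qed

lemma det_sized_strip_matrix_chain:
  assumes "horizontal_strip_chain n k lam mu as" "n > 0" "\<And>i. i \<ge> N \<Longrightarrow> lam i = 0"
  shows "det (sized_strip_matrix n N lam mu) = (\<Prod>i<k. (-1) ^ strip_height (chain_strip as i))"
  using assms(1,3)
proof (induction k arbitrary: lam as)
  case 0
  then show ?case
    by (simp add: horizontal_strip_chain_0 is_partition_def det_sized_strip_matrix_self)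
next
  case (Suc k)
  note chain = Suc.prems(1)
  obtain p q where A: "horizontal_strip_chain n k (as ! k) mu (take (Suc k) as)"
    "strip_shape n p q lam (as ! k)" "is_partition lam"
    "strip_height (chain_strip as k) = q - p"
    "(p, lam p - 1) \<in> top_boxes (skew_diagram lam mu)"
    using horizontal_strip_chain_Suc[OF chain \<open>n > 0\<close>] by metis
  have ends: "as ! 0 = mu" "as ! Suc k = lam" "antimono mu"
    using chain by (auto simp: horizontal_strip_chain_def is_partition_def)
  have le: "mu \<le> lam" "as ! k \<le> lam"
    using horizontal_strip_chain_le[OF chain, of 0 "Suc k"]
      horizontal_strip_chain_le[OF chain, of k "Suc k"] ends by simp_all
  \<comment> \<open>The size \<open>N\<close> is kept fixed while the outer partition shrinks, so
    the vanishing condition has to be inherited.\<close>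
  have "(as ! k) i = 0" if "i \<ge> N" for i
    using le(2) Suc.prems(2)[OF that] by (metis le_fun_def le_zero_eq)
  then have "det (sized_strip_matrix n N (as ! k) mu) = (\<Prod>i<k. (-1) ^ strip_height (chain_strip as i))"
    using Suc.IH[OF A(1)] by simp
  moreover have "det (sized_strip_matrix n N lam mu)
      = (-1) ^ (q - p) * det (sized_strip_matrix n N (as ! k) mu)"
    using det_sized_strip_matrix_step[OF A(2) \<open>n > 0\<close>] top_box_row_end_neq[OF A(3) le(1) ends(3) A(5)]
      Suc.prems(2) by blast
  ultimately show ?case using A(4) by (simp add: mult.commute)
qed

text \<open>The parts weakly decrease, so a nonzero part at \<open>i\<close> would force at least
  \<open>i + 1\<close> nonzero parts. This justifies the size \<open>num_parts lam\<close> in the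
  determinant formula.\<close>

lemma partition_eq_0:
  assumes "is_partition lam" "i \<ge> num_parts lam"
  shows "lam i = 0"
proof (rule ccontr)
  assume "lam i \<noteq> 0"
  have "lam i \<le> lam j" if "j \<le> i" for j
    using assms(1) that by (simp add: is_partition_def antimonoD)
  with \<open>lam i \<noteq> 0\<close> have "{..i} \<subseteq> {j. lam j \<noteq> 0}" by force
  then have "card {..i} \<le> num_parts lam"
    using assms(1) unfolding num_parts_def is_partition_def by (meson card_mono)
  then show False using assms(2) by simp
qed

theorem theorem3p8:
  fixes n k :: nat and lam mu :: "nat \<Rightarrow> nat"
  assumes "n > 0" and "k > 0"
    and "is_partition mu" and "is_partition lam" and "mu \<le> lam"
    and "horizontal_border_strip n k lam mu"
  shows "det (strip_matrix n lam mu) = strip_sgn n k lam mu"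
proof -
  obtain as where as: "horizontal_strip_chain n k lam mu as"
    using assms(6) by (auto simp: horizontal_border_strip_def)
  then have "(THE as. horizontal_strip_chain n k lam mu as) = as"
    using horizontal_strip_chain_unique \<open>n > 0\<close> by blast
  then have "strip_sgn n k lam mu = (\<Prod>i<k. (-1) ^ strip_height (chain_strip as i))"
    by (simp only: strip_sgn_def Let_def)
  moreover have "strip_matrix n lam mu = sized_strip_matrix n (num_parts lam) lam mu"
    by (simp only: strip_matrix_def sized_strip_matrix_def)
  ultimately show ?thesis
    using det_sized_strip_matrix_chain[OF as \<open>n > 0\<close> partition_eq_0[OF assms(4)]]
    by (simp only:)
qed

end
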